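(* For all integers $T\ge1$ and $n$ with $T<n$, there exists a college admissions problem with $|I|=n$ students and a common strict priority order for which the profile of straightforward strategies is not a Nash equilibrium of the (complete-information) game induced by the $T$-round time-constrained dynamic mechanism (TCDM).
   Context: Problem. $I$ is a finite set of students and $C$ a finite set of colleges. Each student $i$ has a strict preference (linear order) $\succ_i$ over $C\cup\{\emptyset\}$, where $\emptyset$ is the outside option (being unassigned). Each college $c$ has capacity $q_c\in\mathbb{N}_+$. Each student has a score $s_i>0$, scores are distinct, and every college uses the common strict priority order $i\triangleright j\iff s_i>s_j$. A matching is a map $\mu:I\to C\cup\{\emptyset\}$ with $|\mu^{-1}(c)|\le q_c$ for all $c$. The cutoff of $c$ at $\mu$ is $f_c(\mu)=\min\{s_i:i\in\mu^{-1}(c)\}$ if $|\mu^{-1}(c)|=q_c$, and $f_c(\mu)=0$ otherwise. Game induced by the $T$-round TCDM. Preferences, scores, capacities and $T$ are common knowledge. In each round $t=1,\dots,T$ all students simultaneously choose an action in $A=C\cup\{\emptyset\}$ (an application, replacing any earlier one), after observing all students' actions in rounds $1,\dots,t-1$. Given the round-$t$ action profile, each college holds its highest-priority round-$t$ applicants up to capacity and rejects the others; this defines the tentative matching $\mu^t$ (students who are rejected or chose $\emptyset$ are unassigned). A pure strategy of student $i$ assigns, for each $t$, an action in $A$ to every possible sequence of action profiles of rounds $1,\dots,t-1$. The final matching is $\mu^T$, and students rank outcomes by their own assignment $\mu^T(i)$ according to $\succ_i$. A strategy profile is a Nash equilibrium if no student has a pure strategy which, holding the other students' strategies fixed, yields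 her a strictly preferred final assignment. Straightforward strategy. In round 1 student $i$ applies to her $\succ_i$-best element of $C\cup\{\emptyset\}$. In round $t>1$, at every history with previous-round tentative matching $\mu^{t-1}$: if $\mu^{t-1}(i)\in C$, she applies to $\mu^{t-1}(i)$; if $\mu^{t-1}(i)=\emptyset$, she chooses her $\succ_i$-best element of $\{c\in C: s_i\ge f_c(\mu^{t-1})\}\cup\{\emptyset\}$. *)

theory Defs
  imports Complex_Main "HOL-Library.FuncSet"
begin

text \<open>The outside option is \<^term>\<open>None\<close>; \<^prop>\<open>(x, y) \<in> pref P i\<close> means that student \<open>i\<close> strictly
  prefers \<open>x\<close> to \<open>y\<close>. The single function \<open>score\<close> gives the priority order common to all colleges.\<close>

record ('i, 'c) problem =
  students :: "'i set"
  colleges :: "'c set"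
  pref :: "'i \<Rightarrow> 'c option rel"
  capacity :: "'c \<Rightarrow> nat"
  score :: "'i \<Rightarrow> real"

type_synonym ('i, 'c) profile = "'i \<Rightarrow> 'c option"

type_synonym ('i, 'c) strategy = "('i, 'c) profile list \<Rightarrow> 'c option"

definition actions :: "('i, 'c) problem \<Rightarrow> 'c option set" where
  "actions P = insert None (Some ` colleges P)"

text \<open>The library's \<^const>\<open>strict_linear_order_on\<close> does not confine the relation to the given set,
  hence the separate inclusion.\<close>

definition college_admissions_problem :: "('i, 'c) problem \<Rightarrow> bool" where
  "college_admissions_problem P \<longleftrightarrow>
     finite (students P) \<and> finite (colleges P) \<and>
     (\<forall>i\<in>students P. pref P i \<subseteq> actions P \<times> actions P \<and>
        strict_linear_order_on (actions P) (pref P i)) \<and>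
     (\<forall>c\<in>colleges P. 0 < capacity P c) \<and>
     (\<forall>i\<in>students P. 0 < score P i) \<and>
     inj_on (score P) (students P)"

definition has_priority :: "('i, 'c) problem \<Rightarrow> 'i \<Rightarrow> 'i \<Rightarrow> bool" where
  "has_priority P i j \<longleftrightarrow> score P i > score P j"

definition assigned :: "('i, 'c) problem \<Rightarrow> ('i, 'c) profile \<Rightarrow> 'c \<Rightarrow> 'i set" where
  "assigned P \<mu> c = {i \<in> students P. \<mu> i = Some c}"

definition matching :: "('i, 'c) problem \<Rightarrow> ('i, 'c) profile \<Rightarrow> bool" where
  "matching P \<mu> \<longleftrightarrow> \<mu> \<in> students P \<rightarrow> actions P \<and>
     (\<forall>c\<in>colleges P. card (assigned P \<mu> c) \<le> capacity P c)"

definition cutoff :: "('i, 'c) problem \<Rightarrow> ('i, 'c) profile \<Rightarrow> 'c \<Rightarrow> real" where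
  "cutoff P \<mu> c =
     (if card (assigned P \<mu> c) = capacity P c then Min (score P ` assigned P \<mu> c) else 0)"

text \<open>An applicant is among the highest-priority applicants up to capacity iff fewer applicants than
  there are seats have priority over her.\<close>

definition held :: "('i, 'c) problem \<Rightarrow> ('i, 'c) profile \<Rightarrow> 'c \<Rightarrow> 'i set" where
  "held P a c =
     {i \<in> assigned P a c. card {j \<in> assigned P a c. has_priority P j i} < capacity P c}"

definition tentative_matching ::
    "('i, 'c) problem \<Rightarrow> ('i, 'c) profile \<Rightarrow> ('i, 'c) profile" where
  "tentative_matching P a i =
     (case a i of None \<Rightarrow> None | Some c \<Rightarrow> if i \<in> held P a c then Some c else None)"

text \<open>A history before round \<open>t\<close> is the list of the action profiles of rounds \<open>1, \<dots>, t - 1\<close>, earliest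
  first. Action profiles are extensional, so each history has exactly one representation.\<close>

definition action_profiles :: "('i, 'c) problem \<Rightarrow> ('i, 'c) profile set" where
  "action_profiles P = students P \<rightarrow>\<^sub>E actions P"

definition histories :: "('i, 'c) problem \<Rightarrow> nat \<Rightarrow> ('i, 'c) profile list set" where
  "histories P T = {h. length h < T \<and> set h \<subseteq> action_profiles P}"

text \<open>Values of a strategy outside \<^const>\<open>histories\<close> are unconstrained; they never affect play.\<close>

definition strategies :: "('i, 'c) problem \<Rightarrow> nat \<Rightarrow> ('i, 'c) strategy set" where
  "strategies P T = histories P T \<rightarrow> actions P"

primrec play ::
    "('i, 'c) problem \<Rightarrow> ('i \<Rightarrow> ('i, 'c) strategy) \<Rightarrow> nat \<Rightarrow> ('i, 'c) profile list" where
  "play P \<sigma> 0 = []"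
| "play P \<sigma> (Suc t) = play P \<sigma> t @ [\<lambda>i\<in>students P. \<sigma> i (play P \<sigma> t)]"

text \<open>Only meaningful for \<^prop>\<open>T \<ge> 1\<close>.\<close>

definition final_matching ::
    "('i, 'c) problem \<Rightarrow> nat \<Rightarrow> ('i \<Rightarrow> ('i, 'c) strategy) \<Rightarrow> ('i, 'c) profile" where
  "final_matching P T \<sigma> = tentative_matching P (last (play P \<sigma> T))"

text \<open>Membership of \<open>\<sigma> i\<close> in \<^const>\<open>strategies\<close> is deliberately not part of the definition, so that a
  profile can fail to be an equilibrium only through a profitable deviation.\<close>

definition nash_equilibrium ::
    "('i, 'c) problem \<Rightarrow> nat \<Rightarrow> ('i \<Rightarrow> ('i, 'c) strategy) \<Rightarrow> bool" where
  "nash_equilibrium P T \<sigma> \<longleftrightarrow>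
     \<not> (\<exists>i\<in>students P. \<exists>\<tau>\<in>strategies P T.
          (final_matching P T (\<sigma>(i := \<tau>)) i, final_matching P T \<sigma> i) \<in> pref P i)"

definition best :: "('i, 'c) problem \<Rightarrow> 'i \<Rightarrow> 'c option set \<Rightarrow> 'c option" where
  "best P i S = (THE x. x \<in> S \<and> (\<forall>y\<in>S. y \<noteq> x \<longrightarrow> (x, y) \<in> pref P i))"

definition straightforward :: "('i, 'c) problem \<Rightarrow> 'i \<Rightarrow> ('i, 'c) strategy" where
  "straightforward P i h =
     (if h = [] then best P i (actions P)
      else let \<mu> = tentative_matching P (last h) in
        if \<mu> i \<noteq> None then \<mu> i
        else best P i (insert None (Some ` {c \<in> colleges P. score P i \<ge> cutoff P \<mu> c})))"

lemma tentative_matching_eq_Some: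
  "tentative_matching P a i = Some c \<longleftrightarrow> i \<in> held P a c"
  by (auto simp: tentative_matching_def held_def assigned_def split: option.splits)

lemma matching_tentative_matching:
  assumes "college_admissions_problem P" and "a \<in> action_profiles P"
  shows "matching P (tentative_matching P a)"
proof -
  have card_held: "card (held P a c) \<le> capacity P c" if "c \<in> colleges P" for c
  proof (cases "held P a c = {}")
    case False
    let ?H = "held P a c" and ?A = "assigned P a c"
    have finA: "finite ?A" and inj: "inj_on (score P) (students P)"
      using assms(1) by (auto simp: college_admissions_problem_def assigned_def)
    have HA: "?H \<subseteq> ?A" by (auto simp: held_def)
    with finA have finH: "finite ?H" by (rule finite_subset[rotated])
    obtain i where i: "i \<in> ?H" and least: "\<And>j. j \<in> ?H \<Longrightarrow> score P i \<le> score P j"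
      using finH False arg_min_if_finite(1)[of ?H "score P"] arg_min_least[of ?H _ "score P"] by blast
    have sub: "?H - {i} \<subseteq> {j \<in> ?A. has_priority P j i}"
    proof
      fix j assume j: "j \<in> ?H - {i}"
      have "j \<in> students P" "i \<in> students P"
        using i j by (auto simp: held_def assigned_def)
      then have "score P j \<noteq> score P i" using inj j by (auto dest: inj_onD)
      then show "j \<in> {j \<in> ?A. has_priority P j i}"
        using least[of j] j HA by (auto simp: has_priority_def)
    qed
    have "card (?H - {i}) \<le> card {j \<in> ?A. has_priority P j i}"
      using sub finA by (intro card_mono) auto
    also have "\<dots> < capacity P c" using i by (simp add: held_def)
    finally show ?thesis using i finH by (simp add: card_Diff_singleton)
  qed simp
  have "assigned P (tentative_matching P a) c = held P a c" for c
    by (auto simp: assigned_def tentative_matching_eq_Some) (auto simp: held_def assigned_def)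
  moreover have "tentative_matching P a \<in> students P \<rightarrow> actions P"
  proof
    fix i assume "i \<in> students P"
    then have "a i \<in> actions P" using assms(2) by (auto simp: action_profiles_def)
    then show "tentative_matching P a i \<in> actions P"
      by (auto simp: tentative_matching_def actions_def split: option.split)
  qed
  ultimately show ?thesis using card_held by (simp add: matching_def)
qed

lemma best_in:
  assumes "college_admissions_problem P" and "i \<in> students P"
    and "S \<subseteq> actions P" and "S \<noteq> {}"
  shows "best P i S \<in> S" and "\<And>y. y \<in> S \<Longrightarrow> y \<noteq> best P i S \<Longrightarrow> (best P i S, y) \<in> pref P i"
proof -
  have ord: "trans (pref P i)" "irrefl (pref P i)" "total_on (actions P) (pref P i)"
    using assms(1,2) by (auto simp: college_admissions_problem_def strict_linear_order_on_def)
  have "finite S"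
    using assms(1,3) by (auto simp: college_admissions_problem_def actions_def intro: finite_subset)
  then have "\<exists>x\<in>S. \<forall>y\<in>S. y \<noteq> x \<longrightarrow> (x, y) \<in> pref P i"
    using assms(4,3)
  proof (induction rule: finite_ne_induct)
    case (insert z F)
    have "\<exists>x\<in>F. \<forall>y\<in>F. y \<noteq> x \<longrightarrow> (x, y) \<in> pref P i"
      using insert.prems by (intro insert.IH) simp
    then obtain x where x: "x \<in> F" "\<forall>y\<in>F. y \<noteq> x \<longrightarrow> (x, y) \<in> pref P i" ..
    have "x \<in> actions P" "z \<in> actions P" "x \<noteq> z"
      using insert.hyps insert.prems x(1) by auto
    then have "(x, z) \<in> pref P i \<or> (z, x) \<in> pref P i"
      using ord(3) by (simp add: total_on_def)
    then show ?case
    proof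
      assume "(x, z) \<in> pref P i"
      then show ?thesis using x by auto
    next
      assume "(z, x) \<in> pref P i"
      moreover have "(z, y) \<in> pref P i" if "y \<in> F" for y
        using that x transD[OF ord(1) \<open>(z, x) \<in> pref P i\<close>] \<open>(z, x) \<in> pref P i\<close> by (cases "y = x") auto
      ultimately show ?thesis by auto
    qed
  qed simp
  then obtain x where x: "x \<in> S" "\<forall>y\<in>S. y \<noteq> x \<longrightarrow> (x, y) \<in> pref P i" ..
  have "best P i S = x"
    unfolding best_def
  proof (rule the_equality)
    fix y assume y: "y \<in> S \<and> (\<forall>z\<in>S. z \<noteq> y \<longrightarrow> (y, z) \<in> pref P i)"
    show "y = x"
    proof (rule ccontr)
      assume "y \<noteq> x"
      then have "(x, y) \<in> pref P i" "(y, x) \<in> pref P i" using x y by auto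
      then show False using ord(1,2) by (auto simp: irrefl_def dest: transD)
    qed
  qed (use x in auto)
  then show "best P i S \<in> S"
    and "\<And>y. y \<in> S \<Longrightarrow> y \<noteq> best P i S \<Longrightarrow> (best P i S, y) \<in> pref P i"
    using x by auto
qed

lemma straightforward_in_strategies:
  assumes "college_admissions_problem P" and "i \<in> students P"
  shows "straightforward P i \<in> strategies P T"
  unfolding strategies_def
proof
  fix h assume h: "h \<in> histories P T"
  show "straightforward P i h \<in> actions P"
  proof (cases "h = []")
    case True
    then show ?thesis
      using best_in(1)[OF assms order_refl] by (simp add: straightforward_def actions_def)
  next
    case False
    let ?\<mu> = "tentative_matching P (last h)"
    let ?S = "insert None (Some ` {c \<in> colleges P. cutoff P ?\<mu> c \<le> score P i})"
    have "last h \<in> action_profiles P" using h False by (auto simp: histories_def)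
    then have "?\<mu> i \<in> actions P"
      using matching_tentative_matching[OF assms(1)] assms(2) by (auto simp: matching_def)
    moreover have "?S \<subseteq> actions P" by (auto simp: actions_def)
    then have "best P i ?S \<in> actions P" using best_in(1)[OF assms, of ?S] by auto
    ultimately show ?thesis using False by (simp add: straightforward_def Let_def)
  qed
qed

end

(* All students rank the colleges 0, ..., T identically, every college has one seat, and student i has
   the (i+1)-st highest score. Straightforward play is then slow serial dictatorship: in round t + 1
   student i applies to college min i t, and only the students i <= t are held. Student n - 1 >= T is
   thus still unassigned after T rounds, although nobody ever applies to college T; applying there in
   the last round secures her a seat. *)

theory Submission
  imports Defs
begin

text \<open>Smaller is better. The value \<open>Suc T\<close> places the outside option below every
  college in \<open>{..T}\<close>.\<close>

fun common_rank :: "nat \<Rightarrow> nat option \<Rightarrow> nat" where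
  "common_rank T None = Suc T"
| "common_rank T (Some c) = c"

definition serial_problem :: "nat \<Rightarrow> nat \<Rightarrow> (nat, nat) problem" where
  "serial_problem T n =
     \<lparr>students = {..<n}, colleges = {..T},
      pref = (\<lambda>_. {(x, y). x \<in> insert None (Some ` {..T}) \<and> y \<in> insert None (Some ` {..T}) \<and>
                    common_rank T x < common_rank T y}),
      capacity = (\<lambda>_. 1), score = (\<lambda>i. real n - real i)\<rparr>"

lemma serial_problem_simps [simp]:
  "students (serial_problem T n) = {..<n}"
  "colleges (serial_problem T n) = {..T}"
  "capacity (serial_problem T n) c = 1"
  "score (serial_problem T n) i = real n - real i"
  "actions (serial_problem T n) = insert None (Some ` {..T})"
  "(x, y) \<in> pref (serial_problem T n) i \<longleftrightarrow>
     x \<in> insert None (Some ` {..T}) \<and> y \<in> insert None (Some ` {..T}) \<and>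
     common_rank T x < common_rank T y"
  "has_priority (serial_problem T n) i j \<longleftrightarrow> i < j"
  by (simp_all add: serial_problem_def actions_def has_priority_def)

lemma college_admissions_problem_serial: "college_admissions_problem (serial_problem T n)"
  unfolding college_admissions_problem_def strict_linear_order_on_def
  by (auto simp: trans_def irrefl_def total_on_def inj_on_def)

text \<open>Evaluates the definite description \<open>best\<close>: any other value would be
  strictly preferred to \<open>x\<close>, hence of smaller rank, against minimality.\<close>

lemma best_serial:
  assumes "i < n" and "S \<subseteq> insert None (Some ` {..T})" and "x \<in> S"
    and "\<And>y. y \<in> S \<Longrightarrow> common_rank T x \<le> common_rank T y"
  shows "best (serial_problem T n) i S = x"
proof (rule ccontr)
  assume *: "best (serial_problem T n) i S \<noteq> x"
  have "S \<noteq> {}" using assms(3) by auto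
  note b = best_in[OF college_admissions_problem_serial _ _ this, of i T n]
  have "common_rank T (best (serial_problem T n) i S) < common_rank T x"
    using b(2)[of x] * assms(1-3) by auto
  moreover have "best (serial_problem T n) i S \<in> S" using b(1) assms(1,2) by auto
  ultimately show False using assms(4) by fastforce
qed

text \<open>Rounds are counted from 0 here: this is the profile of round
  \<open>t + 1\<close>.\<close>

definition serial_actions :: "nat \<Rightarrow> nat \<Rightarrow> nat \<Rightarrow> nat option" where
  "serial_actions n t = (\<lambda>i\<in>{..<n}. Some (min i t))"

text \<open>With a single seat, fewer than one rival with priority means none, and priority is the
  smaller index.\<close>

lemma held_serial:
  "held (serial_problem T n) a c =
     {i. i < n \<and> a i = Some c \<and> (\<forall>j<i. a j \<noteq> Some c)}"
  by (auto simp: held_def assigned_def)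

lemma tentative_matching_serial_actions:
  assumes "i < n"
  shows "tentative_matching (serial_problem T n) (serial_actions n t) i
           = (if i \<le> t then Some i else None)"
proof -
  \<comment> \<open>Take \<open>j = t\<close>: if \<open>t < i\<close>, student \<open>t\<close>
    would be a competing applicant to college \<open>t\<close> with higher priority.\<close>
  have "i \<le> t" if "\<forall>j<i. min j t \<noteq> t" using that by (metis min.idem not_le)
  then show ?thesis
    using assms by (auto simp: tentative_matching_def held_serial serial_actions_def)
qed

text \<open>By \<open>t < n\<close>, each college \<open>c \<le> t\<close> is filled by the student
  of the same index; later colleges are vacant.\<close>

lemma cutoff_serial_actions:
  fixes T n t
  defines "\<mu> \<equiv> tentative_matching (serial_problem T n) (serial_actions n t)"
  assumes "t < n"
  shows "cutoff (serial_problem T n) \<mu> c = (if c \<le> t then real n - real c else 0)"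
proof -
  have "assigned (serial_problem T n) \<mu> c = (if c \<le> t then {c} else {})"
    using assms by (auto simp: assigned_def tentative_matching_serial_actions split: if_splits)
  then show ?thesis by (simp add: cutoff_def)
qed

text \<open>A student \<open>i \<le> t\<close> is held and stays. For \<open>i > t\<close>, the
  score \<open>n - i\<close> is below the cutoff \<open>n - c\<close> of every
  \<open>c \<le> t\<close>, so the best attainable college is the vacant \<open>Suc t\<close>, which
  exists since \<open>Suc t \<le> T\<close>.\<close>

lemma straightforward_serial:
  assumes "i < n" and "Suc t \<le> T" and "T < n" and "h \<noteq> []" and "last h = serial_actions n t"
  shows "straightforward (serial_problem T n) i h = Some (min i (Suc t))"
proof (cases "i \<le> t")
  case True
  then show ?thesis
    using assms by (simp add: straightforward_def Let_def tentative_matching_serial_actions)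
next
  case False
  then show ?thesis
    using assms
    by (auto simp: straightforward_def Let_def tentative_matching_serial_actions
        cutoff_serial_actions intro!: best_serial)
qed

lemma last_play_serial:
  assumes "t < T" and "T < n"
  shows "last (play (serial_problem T n) (straightforward (serial_problem T n)) (Suc t))
           = serial_actions n t"
  using assms(1)
proof (induction t)
  case 0
  have "straightforward (serial_problem T n) i [] = Some 0" if "i < n" for i
    using that by (auto simp: straightforward_def intro!: best_serial)
  then show ?case by (auto simp: serial_actions_def restrict_def)
next
  case (Suc t)
  let ?h = "play (serial_problem T n) (straightforward (serial_problem T n)) (Suc t)"
  have "straightforward (serial_problem T n) i ?h = Some (min i (Suc t))" if "i < n" for i
    using that Suc.prems assms(2) Suc.IH[OF Suc_lessD[OF Suc.prems]]
    by (intro straightforward_serial) (auto simp del: play.simps(2), simp)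
  then show ?case
    by (subst play.simps(2)) (auto simp: serial_actions_def restrict_def simp del: play.simps)
qed

lemma length_play [simp]: "length (play P \<sigma> t) = t"
  by (induction t) auto

text \<open>Agreement is required only on the path of \<open>\<sigma>\<close> before the last of the
  \<open>t\<close> rounds is played, so a deviation in a later round leaves these rounds
  unchanged.\<close>

lemma play_cong:
  assumes "\<And>i s. i \<in> students P \<Longrightarrow> s < t \<Longrightarrow> \<sigma> i (play P \<sigma> s) = \<sigma>' i (play P \<sigma> s)"
  shows "play P \<sigma>' t = play P \<sigma> t"
  using assms by (induction t) (auto simp: restrict_def)

theorem mainTheorem7:
  fixes T n :: nat
  assumes "1 \<le> T" and "T < n"
  shows "\<exists>P :: (nat, nat) problem.
           college_admissions_problem P \<and> card (students P) = n \<and>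
           \<not> nash_equilibrium P T (straightforward P)"
proof -
  obtain t where T: "T = Suc t" using assms(1) by (cases T) auto
  obtain d where n: "n = Suc d" using assms(2) by (cases n) auto
  define P where "P = serial_problem T n"
  let ?\<sigma> = "straightforward P"
  \<comment> \<open>Histories of length \<open>t = T - 1\<close> are those before the last round, so
    the deviation is confined to that round.\<close>
  define \<tau> where "\<tau> h = (if length h = t then Some T else ?\<sigma> d h)" for h
  let ?\<sigma>' = "?\<sigma>(d := \<tau>)"
  have P: "college_admissions_problem P"
    by (simp add: P_def college_admissions_problem_serial)
  have "?\<sigma> d \<in> strategies P T"
    using P by (rule straightforward_in_strategies) (simp add: P_def n)
  then have \<tau>: "\<tau> \<in> strategies P T"
    by (simp add: strategies_def \<tau>_def P_def Pi_iff)
  have final: "last (play P ?\<sigma> T) = serial_actions n t"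
    using last_play_serial[of t T n] assms by (simp add: P_def T del: play.simps)
  \<comment> \<open>From \<open>T < n\<close> follows \<open>d \<ge> T > t\<close>, so
    \<open>d\<close> is not among the students held.\<close>
  have "final_matching P T ?\<sigma> d = None"
    using assms unfolding final_matching_def final
    by (simp add: P_def tentative_matching_serial_actions T n)
  moreover have "final_matching P T ?\<sigma>' d = Some T"
  proof -
    have "play P ?\<sigma>' t = play P ?\<sigma> t"
      by (rule play_cong) (auto simp: \<tau>_def)
    then have "last (play P ?\<sigma>' T) = (last (play P ?\<sigma> T))(d := Some T)"
      by (auto simp: T \<tau>_def restrict_def P_def n)
    \<comment> \<open>All other students apply to \<open>min i t < T\<close>, so \<open>d\<close> is
      the only applicant to college \<open>T\<close>.\<close>
    then show ?thesis
      unfolding final_matching_def final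
      by (auto simp: P_def tentative_matching_def held_serial serial_actions_def T n)
  qed
  ultimately have "\<not> nash_equilibrium P T ?\<sigma>"
    using \<tau> unfolding nash_equilibrium_def by (force simp: P_def n)
  then show ?thesis using P by (intro exI[of _ P]) (simp add: P_def)
qed

end
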